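(* $\chi(\mathrm{S\text{-}Forb}(C(1,2))\cap\mathcal S)=3$; that is, the maximum chromatic number of a strongly connected digraph containing no subdivision of $C(1,2)$ as a subdigraph is $3$.
   Context: Digraphs are finite, without loops or parallel arcs (two opposite arcs between the same two vertices are allowed). The chromatic number $\chi(D)$ of a digraph $D$ is the chromatic number of its underlying undirected graph. The chromatic number $\chi(\mathcal D)$ of a class $\mathcal D$ of digraphs is the smallest $m$ such that $\chi(D)\le m$ for all $D\in\mathcal D$, or $+\infty$ if no such $m$ exists. $\mathcal S$ is the class of strongly connected digraphs. $C(k,\ell)$ is the oriented cycle with two blocks of lengths $k$ and $\ell$: the union of two internally disjoint directed paths with the same initial vertex and the same terminal vertex (distinct from the initial vertex), one of length $k$ and one of length $\ell$. A subdivision of a digraph $F$ is obtained from $F$ by replacing each arc $uv$ by a directed $(u,v)$-path of length at least $1$, these paths being pairwise internally disjoint with new internal vertices. $\mathrm{S\text{-}Forb}(F)$ is the class of digraphs containing no subdivision of $F$ as a subdigraph. *)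

theory Defs
  imports
    "Graph_Theory.Graph_Theory"
    "HOL-Library.Extended_Nat"
    "HOL-Library.Infinite_Typeclass"
begin

text \<open>
  Digraphs are values of type \<^typ>\<open>'a pair_pre_digraph\<close> satisfying \<^const>\<open>pair_digraph\<close>:
  finite and loopless, and without parallel arcs because arcs are ordered pairs; opposite arcs
  \<open>(u, v)\<close> and \<open>(v, u)\<close> may coexist. \<^const>\<open>with_proj\<close> views such a digraph as a general \<^typ>\<open>('a, 'a \<times> 'a) pre_digraph\<close>.
\<close>

subsection \<open>Chromatic numbers\<close>

definition proper_colouring :: "'a pair_pre_digraph \<Rightarrow> nat \<Rightarrow> ('a \<Rightarrow> nat) \<Rightarrow> bool" where
  "proper_colouring G m c \<longleftrightarrow>
     c ` pverts G \<subseteq> {..<m} \<and> (\<forall>(u, v) \<in> parcs G. c u \<noteq> c v)"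

definition ugraph_chromatic_number :: "'a pair_pre_digraph \<Rightarrow> nat" where
  "ugraph_chromatic_number G = (LEAST m. \<exists>c. proper_colouring G m c)"

text \<open>
  \<^const>\<open>mk_symmetric\<close> is the underlying undirected graph, represented as a symmetric digraph.
\<close>

definition chromatic_number :: "'a pair_pre_digraph \<Rightarrow> nat" where
  "chromatic_number D = ugraph_chromatic_number (mk_symmetric (with_proj D))"

text \<open>The minimum defining the chromatic number is taken over a nonempty set.\<close>

lemma ex_proper_colouring:
  assumes "pair_digraph D"
  shows "\<exists>m c. proper_colouring (mk_symmetric (with_proj D)) m c"
proof -
  interpret pair_digraph D by (fact assms)
  obtain c :: "'a \<Rightarrow> nat" and m where c: "c ` pverts D = {i. i < m}" "inj_on c (pverts D)"
    using finite_imp_inj_to_nat_seg[OF pair_finite_verts] by metis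
  have "c u \<noteq> c v" if "(u, v) \<in> parcs D" for u v
    using that c(2) in_arcsD1 in_arcsD2 pair_no_loops[of "(u, v)"] by (auto dest: inj_onD)
  then have "proper_colouring (mk_symmetric (with_proj D)) m c"
    using c(1) by (fastforce simp: proper_colouring_def mk_symmetric_def)
  then show ?thesis by blast
qed

definition class_chromatic_number :: "'a pair_pre_digraph set \<Rightarrow> enat" where
  "class_chromatic_number \<D> =
     (if \<exists>m. \<forall>D \<in> \<D>. chromatic_number D \<le> m
      then enat (LEAST m. \<forall>D \<in> \<D>. chromatic_number D \<le> m)
      else \<infinity>)"

subsection \<open>Subdivisions\<close>

text \<open>
  The map \<open>\<phi>\<close> embeds the vertices of \<open>F\<close> as branch vertices of \<open>H\<close>, and \<open>p a\<close> is the
  directed path (a list of arcs of \<open>H\<close>) that replaces the arc \<open>a\<close>.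
\<close>

definition is_subdivision :: "'a pair_pre_digraph \<Rightarrow> 'b pair_pre_digraph \<Rightarrow> bool" where
  "is_subdivision H F \<longleftrightarrow>
     (\<exists>(\<phi> :: 'b \<Rightarrow> 'a) (p :: 'b \<times> 'b \<Rightarrow> ('a \<times> 'a) awalk).
        inj_on \<phi> (pverts F) \<and>
        (\<forall>(u, v) \<in> parcs F.
           pre_digraph.apath (with_proj H) (\<phi> u) (p (u, v)) (\<phi> v) \<and> length (p (u, v)) \<ge> 1) \<and>
        (\<forall>a \<in> parcs F. set (pre_digraph.inner_verts (with_proj H) (p a)) \<inter> \<phi> ` pverts F = {}) \<and>
        (\<forall>a \<in> parcs F. \<forall>b \<in> parcs F. a \<noteq> b \<longrightarrow>
           set (pre_digraph.inner_verts (with_proj H) (p a)) \<inter> set (pre_digraph.inner_verts (with_proj H) (p b)) = {}) \<and>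
        pverts H = \<phi> ` pverts F \<union> (\<Union>a \<in> parcs F. set (pre_digraph.inner_verts (with_proj H) (p a))) \<and>
        parcs H = (\<Union>a \<in> parcs F. set (p a)))"

definition contains_subdivision :: "'a pair_pre_digraph \<Rightarrow> 'b pair_pre_digraph \<Rightarrow> bool" where
  "contains_subdivision D F \<longleftrightarrow>
     (\<exists>H :: 'a pair_pre_digraph. subgraph (with_proj H) (with_proj D) \<and> is_subdivision H F)"

subsection \<open>Classes of digraphs\<close>

definition S_Forb :: "'b pair_pre_digraph \<Rightarrow> 'a pair_pre_digraph set" where
  "S_Forb F = {D. pair_digraph D \<and> \<not> contains_subdivision D F}"

definition strong_digraphs :: "'a pair_pre_digraph set" where
  "strong_digraphs = {D. pair_digraph D \<and> strongly_connected (with_proj D)}"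

subsection \<open>Two-block cycles\<close>

text \<open>
  The blocks are the paths \<open>0, 1, \<dots>, k\<close> and \<open>0, k + 1, \<dots>, k + l - 1, k\<close>. This is meaningful for
  \<open>k, l \<ge> 1\<close> not both equal to 1 (otherwise the two arcs would be parallel).
\<close>

definition two_block_cycle :: "nat \<Rightarrow> nat \<Rightarrow> nat pair_pre_digraph" where
  "two_block_cycle k l =
     (let P = [0..<Suc k]; Q = 0 # [Suc k..<k + l] @ [k]
      in \<lparr> pverts = set P \<union> set Q,
           parcs = set (vwalk_arcs P) \<union> set (vwalk_arcs Q) \<rparr>)"

lemma two_block_cycle_1_2:
  "two_block_cycle 1 2 = \<lparr> pverts = {0, 1, 2}, parcs = {(0, 1), (0, 2), (2, 1)} \<rparr>"
  by (auto simp: two_block_cycle_def upt_rec numeral_2_eq_2)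

end

theory Submission
  imports Defs
begin

text \<open>
  A subdivision of the two-block cycle with blocks of lengths 1 and 2 is the union of two different,
  internally disjoint directed paths with the same two distinct ends: since there are no parallel
  arcs, one of the paths has an inner vertex that can serve as the third branch vertex. Splitting two
  different paths at a common inner vertex yields a shorter pair of different paths, so a digraph
  avoids such a subdivision only if it has at most one directed path from any vertex to any other
  (\<open>apath_unique\<close>).

  Assume this uniqueness and let \<open>r\<close> be a vertex that reaches all others. The unique paths from \<open>r\<close>
  form an out-tree, and every remaining arc goes from a vertex to one of its ancestors
  (\<open>tree_or_back_arc\<close>). No vertex has two such back arcs, because the one going further up, continued
  down the tree, would be a second path to the head of the other (\<open>back_arc_unique\<close>). Hence every
  vertex has at most two neighbours nearer to the root, namely its parent and the head of its back
  arc, and colouring the vertices greedily by increasing distance from \<open>r\<close> uses at most three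
  colours.

  The directed triangle shows that three colours can be necessary: all its out-degrees are 1, whereas
  the initial vertex of the two blocks has out-degree 2 in any subdivision of the cycle.
\<close>

section \<open>Internally disjoint paths and subdivisions\<close>

lemma apath_in_arc_subset:
  assumes "pre_digraph.apath (with_proj G) u p v" "u \<in> pverts H" "set p \<subseteq> parcs H"
  shows "pre_digraph.apath (with_proj H) u p v"
  using assms
  by (simp add: pre_digraph.apath_def pre_digraph.awalk_def cas_with_proj_eq
      awalk_verts_with_proj_eq)

context pair_wf_digraph
begin

text \<open>
  As \<open>q\<close> has at least two arcs, the head \<open>w\<close> of the first arc of \<open>q\<close> is an inner vertex of \<open>q\<close>. Taking it as the
  branch vertex 2, the path \<open>p\<close> replaces the arc \<open>(0, 1)\<close>, and \<open>q\<close> is cut at \<open>w\<close> into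
  the replacements of \<open>(0, 2)\<close> and \<open>(2, 1)\<close>.
\<close>

lemma disjoint_apaths_imp_subdivision_if_long:
  assumes p: "apath u p v" and q: "apath u q v" and len: "length q \<ge> 2"
    and disj: "set (inner_verts p) \<inter> set (inner_verts q) = {}"
  shows "contains_subdivision G (two_block_cycle 1 2)"
proof -
  from len obtain a q' where qa: "q = a # q'" "q' \<noteq> []"
    by (cases q; cases "tl q") auto
  obtain w where a: "a = (u, w)" and q': "apath w q' v" and aG: "(u, w) \<in> parcs G"
    and uq': "u \<notin> set (pawalk_verts w q')"
    using q qa by (cases a) (auto simp: apath_Cons_iff)
  have pne: "p \<noteq> []" and uv: "u \<noteq> v"
    using p q qa apath_nonempty_ends[of u q v] by (auto simp: apath_Nil_iff)
  have wv: "w \<noteq> v" using apath_nonempty_ends[OF q' qa(2)] .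
  have uw: "u \<noteq> w" using uq' hd_in_awalk_verts(2)[OF q'] by auto
  have ip: "set (inner_verts p) = set (pawalk_verts u p) - {u, v}"
    using set_inner_verts[OF p] .
  have iq': "set (inner_verts q') = set (pawalk_verts w q') - {w, v}"
    using set_inner_verts[OF q'] .
  have iq: "set (inner_verts q) = set (pawalk_verts w q') - {v}"
    using set_inner_verts[OF q] qa a uq' by auto
  have w_in: "w \<in> set (pawalk_verts w q')"
    using hd_in_awalk_verts(2)[OF q'] .
  have v_in: "v \<in> set (pawalk_verts w q')" "v \<in> set (pawalk_verts u p)"
    and u_in: "u \<in> set (pawalk_verts u p)"
    using p q' hd_in_awalk_verts(2)[OF p] by (auto simp: apath_def)
  have vG: "set (pawalk_verts u p) \<subseteq> pverts G" "set (pawalk_verts w q') \<subseteq> pverts G"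
    and aG': "set p \<subseteq> parcs G" "set q \<subseteq> parcs G"
    using p q q' by (auto simp: apath_def)
  have wp: "w \<notin> set (pawalk_verts u p)"
    using disj uw wv w_in unfolding ip iq by auto
  define H where "H = \<lparr> pverts = set (pawalk_verts u p) \<union> set (pawalk_verts w q'),
                        parcs = set p \<union> set q \<rparr>"
  have wfH: "pair_wf_digraph H"
  proof
    fix e assume "e \<in> parcs H"
    then have "e \<in> set p \<or> e = a \<or> e \<in> set q'" by (auto simp: H_def qa)
    moreover have "fst e \<in> pverts H \<and> snd e \<in> pverts H" if "e \<in> set p"
      using that p awalk_verts_arc1[of e p u] awalk_verts_arc2[of u p v e]
      by (auto simp: H_def apath_def)
    moreover have "fst e \<in> pverts H \<and> snd e \<in> pverts H" if "e \<in> set q'"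
      using that q' awalk_verts_arc1[of e q' w] awalk_verts_arc2[of w q' v e]
      by (auto simp: H_def apath_def)
    ultimately show "fst e \<in> pverts H" "snd e \<in> pverts H"
      using a u_in w_in by (auto simp: H_def)
  qed
  have sub: "subgraph (with_proj H) (with_proj G)"
    using vG aG' wfH pair_wf_digraph_axioms
    by (auto simp: subgraph_def compatible_def wf_digraph_wp_iff H_def)
  define \<phi> where "\<phi> = (\<lambda>i::nat. if i = 0 then u else if i = 1 then v else w)"
  define P where "P = (\<lambda>e::nat \<times> nat. if e = (0, 1) then p else if e = (0, 2) then [a] else q')"
  have \<phi>s: "\<phi> 0 = u" "\<phi> 1 = v" "\<phi> (Suc 0) = v" "\<phi> 2 = w"
    and Ps: "P (0, 1) = p" "P (0, Suc 0) = p" "P (0, 2) = [a]" "P (2, 1) = q'" "P (2, Suc 0) = q'"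
    by (auto simp: \<phi>_def P_def)
  have a_path: "apath u [a] w"
    using a aG uw by (auto simp: apath_simps dest: in_arcsD2)
  have iv: "pre_digraph.inner_verts (with_proj H) = inner_verts"
    by (rule ext) (simp add: inner_verts_with_proj_def)
  let ?F = "two_block_cycle 1 2"
  have "is_subdivision H ?F"
    unfolding is_subdivision_def iv
  proof (intro exI[of _ \<phi>] exI[of _ P] conjI)
    show "inj_on \<phi> (pverts ?F)"
      using uv uw wv by (auto simp: two_block_cycle_1_2[unfolded One_nat_def] inj_on_def \<phi>s)
    show "\<forall>(x, y)\<in>parcs ?F.
       pre_digraph.apath (with_proj H) (\<phi> x) (P (x, y)) (\<phi> y) \<and> 1 \<le> length (P (x, y))"
      using apath_in_arc_subset[OF p, of H] apath_in_arc_subset[OF a_path, of H]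
        apath_in_arc_subset[OF q', of H] pne qa u_in w_in
      by (auto simp: two_block_cycle_1_2[unfolded One_nat_def] \<phi>s Ps H_def Suc_le_eq)
    show "\<forall>a\<in>parcs ?F.
       set (inner_verts (P a)) \<inter> \<phi> ` pverts ?F = {}"
      using ip iq' uq' wp by (auto simp: two_block_cycle_1_2[unfolded One_nat_def] \<phi>s Ps)
    show "\<forall>a\<in>parcs ?F.
       \<forall>b\<in>parcs ?F. a \<noteq> b \<longrightarrow>
       set (inner_verts (P a)) \<inter> set (inner_verts (P b)) = {}"
      using disj iq iq' by (auto simp: two_block_cycle_1_2[unfolded One_nat_def] Ps)
    show "pverts H = \<phi> ` pverts ?F \<union>
       (\<Union>a\<in>parcs ?F. set (inner_verts (P a)))"
      using ip iq' u_in v_in w_in by (auto simp: two_block_cycle_1_2[unfolded One_nat_def] \<phi>s Ps H_def)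
    show "parcs H = (\<Union>a\<in>parcs ?F. set (P a))"
      by (auto simp: two_block_cycle_1_2[unfolded One_nat_def] Ps H_def qa)
  qed
  with sub show ?thesis
    by (auto simp: contains_subdivision_def)
qed

lemma disjoint_apaths_imp_subdivision:
  assumes p: "apath u p v" and q: "apath u q v" and "p \<noteq> q"
    and disj: "set (inner_verts p) \<inter> set (inner_verts q) = {}"
  shows "contains_subdivision G (two_block_cycle 1 2)"
proof (cases "length p \<ge> 2 \<or> length q \<ge> 2")
  case True
  then show ?thesis
    using disjoint_apaths_imp_subdivision_if_long[OF p q]
      disjoint_apaths_imp_subdivision_if_long[OF q p] disj by blast
next
  case False
  have "p \<noteq> [] \<and> q \<noteq> []"
    using p q \<open>p \<noteq> q\<close> apath_nonempty_ends[of u p v] apath_nonempty_ends[of u q v]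
    by (auto simp: apath_Nil_iff)
  with False obtain a b where "p = [a]" "q = [b]"
    by (cases p; cases q) (auto simp: Suc_le_eq)
  with p q \<open>p \<noteq> q\<close> show ?thesis
    by (cases a; cases b) (auto simp: apath_simps)
qed

text \<open>
  By induction on the total length: if \<open>p\<close> and \<open>q\<close> share an inner vertex \<open>w\<close>, then their parts before
  and after \<open>w\<close> are shorter and hence agree. Otherwise they are internally disjoint and, if different,
  form a subdivision.
\<close>

lemma apath_unique:
  assumes free: "\<not> contains_subdivision G (two_block_cycle 1 2)"
    and "apath u p v" "apath u q v"
  shows "p = q"
  using assms(2,3)
proof (induction "length p + length q" arbitrary: u v p q rule: less_induct)
  case less
  show ?case
  proof (cases "set (inner_verts p) \<inter> set (inner_verts q) = {}")
    case True
    then show ?thesis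
      using disjoint_apaths_imp_subdivision[OF less.prems] free by blast
  next
    case False
    then obtain w where w: "w \<in> set (pawalk_verts u p)" "w \<in> set (pawalk_verts u q)"
        "w \<noteq> u" "w \<noteq> v"
      using set_inner_verts[OF less.prems(1)] set_inner_verts[OF less.prems(2)] by auto
    have split: "\<exists>s t. r = s @ t \<and> apath u s w \<and> apath w t v \<and> length s < length r \<and> length t < length r"
      if r: "apath u r v" "w \<in> set (pawalk_verts u r)" for r
    proof -
      obtain s t where st: "r = s @ t" "awalk u s w" "awalk w t v"
        using awalk_decomp[of u r v w] r by (auto simp: apath_def)
      then have "apath u s w" "apath w t v"
        using r(1) by (auto simp: apath_append_iff)
      moreover have "s \<noteq> []" "t \<noteq> []" using st w by (auto simp: awalk_Nil_iff)
      ultimately show ?thesis using st(1) by (intro exI[of _ s] exI[of _ t]) auto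
    qed
    obtain s t where p: "p = s @ t" "apath u s w" "apath w t v" "length s < length p" "length t < length p"
      using split[OF less.prems(1) w(1)] by blast
    obtain s' t' where q: "q = s' @ t'" "apath u s' w" "apath w t' v"
        "length s' < length q" "length t' < length q"
      using split[OF less.prems(2) w(2)] by blast
    have "s = s'" using less.hyps[OF _ p(2) q(2)] p q by simp
    moreover have "t = t'" using less.hyps[OF _ p(3) q(3)] p q by simp
    ultimately show ?thesis using p q by simp
  qed
qed

end

section \<open>Colouring along an ordering\<close>

text \<open>
  Vertices are coloured by increasing \<open>d\<close>. When the turn of \<open>x\<close> comes, all its coloured neighbours
  have smaller \<open>d\<close>, so they number less than \<open>k\<close> and leave a colour free.
\<close>

lemma greedy_colouring:
  fixes d :: "'a \<Rightarrow> nat"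
  assumes "finite V" and "symp R"
    and "\<And>x y. x \<in> V \<Longrightarrow> y \<in> V \<Longrightarrow> R x y \<Longrightarrow> d x \<noteq> d y"
    and "\<And>x. x \<in> V \<Longrightarrow> card {y \<in> V. R x y \<and> d y < d x} < k"
  shows "\<exists>c :: 'a \<Rightarrow> nat. c ` V \<subseteq> {..<k} \<and> (\<forall>x\<in>V. \<forall>y\<in>V. R x y \<longrightarrow> c x \<noteq> c y)"
  using assms(1,3,4)
proof (induction V rule: finite_ranking_induct[where f = d])
  case empty
  then show ?case by auto
next
  case (insert x V)
  have "\<exists>c :: 'a \<Rightarrow> nat. c ` V \<subseteq> {..<k} \<and> (\<forall>x\<in>V. \<forall>y\<in>V. R x y \<longrightarrow> c x \<noteq> c y)"
  proof (rule insert.IH)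
    fix y assume "y \<in> V"
    have "card {z \<in> V. R y z \<and> d z < d y} \<le> card {z \<in> insert x V. R y z \<and> d z < d y}"
      using insert.hyps by (intro card_mono) auto
    also have "\<dots> < k" using insert.prems(2) \<open>y \<in> V\<close> by blast
    finally show "card {z \<in> V. R y z \<and> d z < d y} < k" .
  qed (use insert.prems in auto)
  then obtain c :: "'a \<Rightarrow> nat" where
    c: "c ` V \<subseteq> {..<k}" "\<And>x y. x \<in> V \<Longrightarrow> y \<in> V \<Longrightarrow> R x y \<Longrightarrow> c x \<noteq> c y"
    by blast
  define N where "N = {y \<in> insert x V. R x y \<and> d y < d x}"
  have "card (c ` N) < k"
    using insert.prems(2)[of x] card_image_le[of N c] insert.hyps unfolding N_def by fastforce
  then obtain i where i: "i < k" "i \<notin> c ` N"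
    using card_mono[of "c ` N" "{..<k}"] insert.hyps by (fastforce simp: N_def)
  have nb: "y \<in> N" if "y \<in> V" "R x y" for y
    using that insert.hyps(2)[of y] insert.prems(1)[of x y] by (auto simp: N_def)
  have irr: "\<not> R x x" using insert.prems(1)[of x x] by auto
  have "c(x := i) ` insert x V \<subseteq> {..<k}" using c i by auto
  moreover have "(c(x := i)) y \<noteq> (c(x := i)) z"
    if "y \<in> insert x V" "z \<in> insert x V" "R y z" for y z
    using that c(2)[of y z] i nb[of y] nb[of z] irr sympD[OF assms(2), of y z] by auto
  ultimately show ?case by blast
qed

section \<open>The upper bound\<close>

lemma mk_symmetric_arc_iff:
  "(u, v) \<in> parcs (mk_symmetric (with_proj D)) \<longleftrightarrow> (u, v) \<in> parcs D \<or> (v, u) \<in> parcs D"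
  unfolding parcs_mk_symmetric with_proj_simps
  by (auto intro: bexI[of _ "(u, v)"] bexI[of _ "(v, u)"])

context pair_digraph
begin

context
  fixes r :: 'a and P :: "'a \<Rightarrow> ('a \<times> 'a) awalk"
  assumes free: "\<not> contains_subdivision G (two_block_cycle 1 2)"
    and P: "\<And>v. v \<in> pverts G \<Longrightarrow> apath r (P v) v"
begin

text \<open>
  The paths \<open>P v\<close> from the root \<open>r\<close> form a spanning out-tree. If \<open>v\<close> does not lie on the path to
  \<open>u\<close>, then an arc \<open>(u, v)\<close> extends that path to one ending in \<open>v\<close>, which by uniqueness is \<open>P v\<close>:
  a tree arc. Otherwise \<open>v\<close> is a proper ancestor of \<open>u\<close>: a back arc.
\<close>

lemma tree_or_back_arc:
  assumes uv: "(u, v) \<in> parcs G"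
  shows "v \<notin> set (pawalk_verts r (P u)) \<and> P v = P u @ [(u, v)]
      \<or> v \<in> set (pawalk_verts r (P u)) \<and> length (P v) < length (P u)"
proof -
  have V: "u \<in> pverts G" "v \<in> pverts G" using uv wellformed' by auto
  have Pu: "apath r (P u) u" using P V by blast
  then have last: "awlast r (P u) = u" by (auto simp: apath_def)
  show ?thesis
  proof (cases "v \<in> set (pawalk_verts r (P u))")
    case False
    have "apath r (P u @ [(u, v)]) v"
      using Pu uv V False no_loops'[OF uv] last by (simp add: apath_append_iff apath_simps)
    then show ?thesis using apath_unique[OF free] P V False by blast
  next
    case True
    then obtain s t where st: "P u = s @ t" "awalk r s v" "awalk v t u"
      using awalk_decomp[of r "P u" u v] Pu by (auto simp: apath_def)
    then have "apath r s v" using Pu by (auto simp: apath_append_iff)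
    then have "P v = s" using apath_unique[OF free] P V by blast
    moreover have "t \<noteq> []" using st no_loops'[OF uv] by (auto simp: awalk_Nil_iff)
    ultimately show ?thesis using st True by auto
  qed
qed

text \<open>
  If \<open>v\<close> had back arcs to two ancestors, \<open>x\<close> above \<open>y\<close>, then the arc \<open>(v, y)\<close> and the arc \<open>(v, x)\<close>
  followed by the tree path from \<open>x\<close> down to \<open>y\<close> would be two paths from \<open>v\<close> to \<open>y\<close>.
\<close>

lemma back_arc_unique:
  assumes arcs: "(v, x) \<in> parcs G" "(v, y) \<in> parcs G"
    and lt: "length (P x) < length (P v)" "length (P y) < length (P v)"
  shows "x = y"
proof -
  have "x = y"
    if arcs: "(v, x) \<in> parcs G" "(v, y) \<in> parcs G"
      and lt: "length (P x) < length (P v)" "length (P y) < length (P v)"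
      and le: "length (P x) \<le> length (P y)" for x y
  proof (rule ccontr)
    assume neq: "x \<noteq> y"
    have Pv: "apath r (P v) v" using P arcs wellformed' by blast
    have xy: "x \<in> set (pawalk_verts r (P v))" "y \<in> set (pawalk_verts r (P v))"
      using tree_or_back_arc[OF arcs(1)] tree_or_back_arc[OF arcs(2)] lt by auto
    obtain s t where st: "P v = s @ t" "awalk r s y" "awalk y t v"
      using awalk_decomp[of r "P v" v y] Pv xy by (auto simp: apath_def)
    obtain s' t' where st': "P v = s' @ t'" "awalk r s' x" "awalk x t' v"
      using awalk_decomp[of r "P v" v x] Pv xy by (auto simp: apath_def)
    have ap: "apath r s y" "apath y t v" "apath r s' x"
      using st st' Pv apath_append_iff[of r s t v] apath_append_iff[of r s' t' v] by auto
    have "P y = s" "P x = s'"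
      using ap apath_unique[OF free] P arcs wellformed' by blast+
    then have "length s' \<le> length s" using le by simp
    \<comment> \<open>\<open>m\<close> is the tree path from \<open>x\<close> to \<open>y\<close>.\<close>
    with st(1) st'(1) obtain m where m: "s = s' @ m"
      by (metis append_eq_append_conv_if append_take_drop_id)
    have xm: "apath x m y"
      using ap(1) st'(2) unfolding m apath_append_iff by auto
    have "v \<notin> set (pawalk_verts r s)"
    proof
      assume "v \<in> set (pawalk_verts r s)"
      moreover have "v \<in> set (tl (pawalk_verts y t))"
        using st(3) no_loops'[OF arcs(2)] by (cases t) (auto simp: awalk_simps)
      ultimately show False
        using apath_decomp_disjoint[OF Pv st(1)] st(2) by auto
    qed
    then have "v \<notin> set (pawalk_verts x m)"
      using st(2) st'(2) ap(1) xm set_awalk_verts_append[of r s' x m y] m by (auto simp: apath_def)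
    then have "apath v ((v, x) # m) y"
      using xm arcs by (auto simp: apath_Cons_iff)
    moreover have "apath v [(v, y)] y"
      using arcs no_loops'[OF arcs(2)] by (auto simp: apath_simps dest: wellformed')
    ultimately have "(v, x) # m = [(v, y)]" by (rule apath_unique[OF free])
    with neq show False by simp
  qed
  from this[of x y] this[of y x] show ?thesis
    using assms linear by metis
qed

lemma adjacent_imp_depth_neq:
  assumes "(u, v) \<in> parcs (mk_symmetric G)"
  shows "length (P u) \<noteq> length (P v)"
proof -
  have "length (P u) \<noteq> length (P v)" if "(u, v) \<in> parcs G" for u v
    using tree_or_back_arc[OF that] by auto
  from this[of u v] this[of v u] assms show ?thesis
    unfolding mk_symmetric_arc_iff by metis
qed

text \<open>
  The neighbours of \<open>v\<close> nearer to the root are its parent in the tree and the head of its back arc.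
\<close>

lemma card_lower_neighbours:
  assumes "v \<in> pverts G"
  shows "card {u \<in> pverts G. (v, u) \<in> parcs (mk_symmetric G) \<and> length (P u) < length (P v)} \<le> 2"
proof -
  define I where "I = {u. (u, v) \<in> parcs G \<and> length (P u) < length (P v)}"
  define B where "B = {u. (v, u) \<in> parcs G \<and> length (P u) < length (P v)}"
  have fin: "finite I" "finite B"
    by (rule finite_subset[OF _ pair_finite_verts]; auto simp: I_def B_def dest: wellformed')+
  have "x = y" if "x \<in> I" "y \<in> I" for x y
    using that tree_or_back_arc[of x v] tree_or_back_arc[of y v] by (auto simp: I_def)
  then have "card I \<le> 1"
    using fin by (auto simp: card_le_Suc0_iff_eq)
  moreover have "card B \<le> 1"
    using fin back_arc_unique by (auto simp: card_le_Suc0_iff_eq B_def)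
  moreover have "{u \<in> pverts G. (v, u) \<in> parcs (mk_symmetric G) \<and> length (P u) < length (P v)} \<subseteq> I \<union> B"
    by (auto simp: mk_symmetric_arc_iff I_def B_def)
  then have "card {u \<in> pverts G. (v, u) \<in> parcs (mk_symmetric G) \<and> length (P u) < length (P v)}
      \<le> card (I \<union> B)"
    using fin by (intro card_mono) auto
  ultimately show ?thesis using card_Un_le[of I B] by linarith
qed

end

lemma chromatic_number_le_3:
  assumes "\<not> contains_subdivision G (two_block_cycle 1 2)"
    and "\<And>v. v \<in> pverts G \<Longrightarrow> r \<rightarrow>\<^sup>*\<^bsub>with_proj G\<^esub> v"
  shows "chromatic_number G \<le> 3"
proof -
  have "\<forall>v. \<exists>p. v \<in> pverts G \<longrightarrow> apath r p v"
    using assms(2) by (auto simp: reachable_apath)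
  then obtain P where P: "\<And>v. v \<in> pverts G \<Longrightarrow> apath r (P v) v"
    by metis
  have sym: "symp (\<lambda>u v. (u, v) \<in> parcs (mk_symmetric G))"
    by (auto simp: symp_def mk_symmetric_arc_iff)
  have few: "card {u \<in> pverts G. (v, u) \<in> parcs (mk_symmetric G) \<and> length (P u) < length (P v)} < 3"
    if "v \<in> pverts G" for v
    using card_lower_neighbours[OF assms(1) P that] by simp
  obtain c :: "'a \<Rightarrow> nat" where c: "c ` pverts G \<subseteq> {..<3}"
    "\<forall>x\<in>pverts G. \<forall>y\<in>pverts G. (x, y) \<in> parcs (mk_symmetric G) \<longrightarrow> c x \<noteq> c y"
    using greedy_colouring[OF pair_finite_verts sym, of "\<lambda>v. length (P v)" 3]
      adjacent_imp_depth_neq[OF assms(1) P] few by blast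
  have "proper_colouring (mk_symmetric G) 3 c"
    using c wellformed' by (fastforce simp: proper_colouring_def mk_symmetric_arc_iff)
  then show ?thesis
    unfolding chromatic_number_def ugraph_chromatic_number_def by (intro Least_le) blast
qed

end

section \<open>The directed triangle\<close>

text \<open>
  In a subdivision, the paths replacing the arcs \<open>(0, 1)\<close> and \<open>(0, 2)\<close> would start with the same arc.
  Its head is an inner vertex or the end of each of the two paths, but these paths are internally
  disjoint, avoid branch vertices inside, and have different ends.
\<close>

lemma no_subdivision_if_out_degree_le_1:
  assumes fn: "\<And>u v w. (u, v) \<in> parcs D \<Longrightarrow> (u, w) \<in> parcs D \<Longrightarrow> v = w"
  shows "\<not> contains_subdivision D (two_block_cycle 1 2)"
proof
  assume "contains_subdivision D (two_block_cycle 1 2)"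
  then obtain H :: "'a pair_pre_digraph" where sub: "subgraph (with_proj H) (with_proj D)"
    and "is_subdivision H (two_block_cycle 1 2)"
    by (auto simp: contains_subdivision_def)
  let ?F = "two_block_cycle 1 2"
  let ?inner = "pre_digraph.inner_verts (with_proj H)"
  obtain \<phi> :: "nat \<Rightarrow> 'a" and p where
    inj: "inj_on \<phi> (pverts ?F)"
    and paths: "\<forall>(u, v)\<in>parcs ?F.
      pre_digraph.apath (with_proj H) (\<phi> u) (p (u, v)) (\<phi> v) \<and> length (p (u, v)) \<ge> 1"
    and inner_branch: "\<forall>a\<in>parcs ?F. set (?inner (p a)) \<inter> \<phi> ` pverts ?F = {}"
    and inner_inner: "\<forall>a\<in>parcs ?F. \<forall>b\<in>parcs ?F. a \<noteq> b \<longrightarrow>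
      set (?inner (p a)) \<inter> set (?inner (p b)) = {}"
    using \<open>is_subdivision H ?F\<close> unfolding is_subdivision_def by (elim exE conjE) (rule that)
  note F = two_block_cycle_1_2 inner_verts_with_proj_def
  have path: "pre_digraph.apath (with_proj H) (\<phi> 0) (p (0, 1)) (\<phi> 1)" "p (0, 1) \<noteq> []"
      "pre_digraph.apath (with_proj H) (\<phi> 0) (p (0, 2)) (\<phi> 2)" "p (0, 2) \<noteq> []"
    using paths unfolding F by auto
  have inner: "set (tl (map fst (p (0, 1)))) \<inter> \<phi> ` {0, 1, 2} = {}"
      "set (tl (map fst (p (0, 2)))) \<inter> \<phi> ` {0, 1, 2} = {}"
      "set (tl (map fst (p (0, 1)))) \<inter> set (tl (map fst (p (0, 2)))) = {}"
    using inner_branch inner_inner unfolding F by (simp_all del: One_nat_def)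
  have first: "\<exists>w. (u, w) \<in> parcs D \<and> (w = v \<or> w \<in> set (tl (map fst q)))"
    if "pre_digraph.apath (with_proj H) u q v" "q \<noteq> []" for u q v
  proof -
    have "set q \<subseteq> parcs D" "pcas u q v"
      using that(1) sub
      by (auto simp: pre_digraph.apath_def pre_digraph.awalk_def cas_with_proj_eq subgraph_def)
    with that(2) show ?thesis
      by (cases q; cases "tl q") auto
  qed
  obtain x where x: "(\<phi> 0, x) \<in> parcs D" "x = \<phi> 1 \<or> x \<in> set (tl (map fst (p (0, 1))))"
    using first[OF path(1,2)] by blast
  obtain y where y: "(\<phi> 0, y) \<in> parcs D" "y = \<phi> 2 \<or> y \<in> set (tl (map fst (p (0, 2))))"
    using first[OF path(3,4)] by blast
  have "x = y" using fn x y by blast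
  moreover have "\<phi> 1 \<noteq> \<phi> 2" using inj unfolding F by (auto simp: inj_on_def simp del: One_nat_def)
  ultimately show False using x(2) y(2) inner by auto
qed

definition directed_triangle :: "'a \<Rightarrow> 'a \<Rightarrow> 'a \<Rightarrow> 'a pair_pre_digraph" where
  "directed_triangle x y z = \<lparr> pverts = {x, y, z}, parcs = {(x, y), (y, z), (z, x)} \<rparr>"

lemma directed_triangle:
  assumes "x \<noteq> y" "y \<noteq> z" "x \<noteq> z"
  shows "directed_triangle x y z \<in> S_Forb (two_block_cycle 1 2) \<inter> strong_digraphs"
    and "chromatic_number (directed_triangle x y z) \<ge> 3"
proof -
  let ?T = "directed_triangle x y z"
  interpret T: pair_digraph ?T
    by unfold_locales (use assms in \<open>auto simp: directed_triangle_def\<close>)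
  have "\<not> contains_subdivision ?T (two_block_cycle 1 2)"
    by (rule no_subdivision_if_out_degree_le_1) (use assms in \<open>auto simp: directed_triangle_def\<close>)
  moreover have "strongly_connected ?T"
  proof -
    have "u \<rightarrow>\<^sup>*\<^bsub>?T\<^esub> v" if "(u, v) \<in> parcs ?T" for u v
      using that by (simp add: T.reachable_adjI)
    then have "x \<rightarrow>\<^sup>*\<^bsub>?T\<^esub> y" "y \<rightarrow>\<^sup>*\<^bsub>?T\<^esub> z" "z \<rightarrow>\<^sup>*\<^bsub>?T\<^esub> x"
      by (auto simp: directed_triangle_def)
    moreover have "u \<rightarrow>\<^sup>*\<^bsub>?T\<^esub> u" if "u \<in> {x, y, z}" for u
      using that by (intro T.reachable_refl) (auto simp: directed_triangle_def)
    ultimately show ?thesis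
      unfolding strongly_connected_def
      by (auto simp: directed_triangle_def[THEN arg_cong[of _ _ pverts]] intro: T.reachable_trans)
  qed
  ultimately show "?T \<in> S_Forb (two_block_cycle 1 2) \<inter> strong_digraphs"
    by (auto simp: S_Forb_def strong_digraphs_def)
  obtain c where "proper_colouring (mk_symmetric ?T) (chromatic_number ?T) c"
    unfolding chromatic_number_def ugraph_chromatic_number_def
    using LeastI_ex[OF ex_proper_colouring[OF T.pair_digraph]] by blast
  then have c: "c ` {x, y, z} \<subseteq> {..<chromatic_number ?T}" "c x \<noteq> c y" "c y \<noteq> c z" "c z \<noteq> c x"
    by (auto simp: proper_colouring_def parcs_mk_symmetric directed_triangle_def)
  then have "card (c ` {x, y, z}) = 3" by (auto simp: card_insert_if)
  then show "chromatic_number ?T \<ge> 3"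
    using card_mono[OF _ c(1)] by simp
qed

theorem corollary36:
  shows "class_chromatic_number
           (S_Forb (two_block_cycle 1 2) \<inter> strong_digraphs :: 'a::infinite pair_pre_digraph set) = 3"
proof -
  let ?C = "S_Forb (two_block_cycle 1 2) \<inter> strong_digraphs :: 'a pair_pre_digraph set"
  have upper: "\<forall>D \<in> ?C. chromatic_number D \<le> 3"
  proof
    fix D assume D: "D \<in> ?C"
    then interpret pair_digraph D by (simp add: S_Forb_def)
    from D obtain r where "r \<in> pverts D" "\<And>v. v \<in> pverts D \<Longrightarrow> r \<rightarrow>\<^sup>*\<^bsub>with_proj D\<^esub> v"
      by (fastforce simp: strong_digraphs_def strongly_connected_def)
    then show "chromatic_number D \<le> 3"
      using D by (intro chromatic_number_le_3) (auto simp: S_Forb_def)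
  qed
  obtain S :: "'a set" where "finite S" "card S = 3"
    using infinite_arbitrarily_large[OF infinite_UNIV] by blast
  then obtain x y z :: 'a where "x \<noteq> y" "y \<noteq> z" "x \<noteq> z"
    by (auto simp: card_3_iff)
  from directed_triangle[OF this] have "3 \<le> m" if "\<forall>D \<in> ?C. chromatic_number D \<le> m" for m
    using that by (meson order_trans)
  then have "(LEAST m. \<forall>D \<in> ?C. chromatic_number D \<le> m) = 3"
    using upper by (intro Least_equality)
  then show ?thesis
    using upper by (auto simp: class_chromatic_number_def numeral_eq_enat)
qed

end
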